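(* Let $x$ and $y$ be indeterminates, let $K=\mathbb{Q}(x,y)$, and let $F_n(x,y)$, $n\ge0$, be the Savage-Viswanathan polynomials. Define polynomials $Q_n^{(x,y)}(z)\in K[z]$ by $Q_0^{(x,y)}(z)=1$, $Q_1^{(x,y)}(z)=z-y$, and, for $n\ge 2$, $$Q_n^{(x,y)}(z)=\bigl(z-(y+(n-1)(1+x))\bigr)Q_{n-1}^{(x,y)}(z)-(n-1)\bigl(xy+(n-2)x\bigr)Q_{n-2}^{(x,y)}(z).$$ Then $(Q_n^{(x,y)}(z))_{n\ge0}$ is a family of orthogonal polynomials over $K$ whose moments are the Savage-Viswanathan polynomials $(F_n(x,y))_{n\ge 0}$.
   Context: The Savage-Viswanathan polynomials $F_n(x,y)$ are defined by the exponential generating function $\sum_{n\ge 0}F_n(x,y)\frac{z^n}{n!}=\left(\frac{1-x}{e^{z(x-1)}-x}\right)^y$ (a formal power series in $z$; the base has constant term $1$, and $u^y=\exp(y\ln u)$). They are polynomials in $x,y$. A sequence of monic polynomials $(p_n)_{n\ge0}$ over a field $K$ with $\deg p_n=n$ is (formally) orthogonal with moments $(\mu_n)_{n\ge 0}$ if the $K$-linear functional $\mathcal{L}$ on $K[z]$ with $\mathcal{L}(z^n)=\mu_n$ satisfies $\mathcal{L}(p_mp_n)=0$ for $m\neq n$ and $\mathcal{L}(p_n^2)\ne 0$ for all $n$. *)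

theory Defs
  imports "HOL-Computational_Algebra.Computational_Algebra"
begin

(* K = Q(x,y) is the fraction field of Q[x][y]: the outer polynomial variable is y, the
   inner one is x. K is an instance of field_char_0 through the library's ordering of
   polynomials and fractions. *)
type_synonym ratfun2 = "rat poly poly fract"

definition indet_x :: ratfun2 where
  "indet_x = to_fract [:[:0, 1:]:]"

definition indet_y :: ratfun2 where
  "indet_y = to_fract [:0, 1:]"

(* u^a = exp (a * ln u), for series u with constant term 1; fps_ln 1 is the series of
   ln (1 + X). *)
definition fps_pow_exp_ln :: "'a::field_char_0 fps \<Rightarrow> 'a \<Rightarrow> 'a fps" where
  "fps_pow_exp_ln u a = fps_exp 1 oo (fps_const a * (fps_ln 1 oo (u - 1)))"

(* fps_exp c is the series of exp (c * X). *)
definition savage_viswanathan_base :: "'a::field_char_0 \<Rightarrow> 'a fps" where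
  "savage_viswanathan_base x = fps_const (1 - x) / (fps_exp (x - 1) - fps_const x)"

lemma savage_viswanathan_base_nth_0:
  assumes "x \<noteq> 1"
  shows "fps_nth (savage_viswanathan_base x) 0 = 1"
  using assms by (simp add: savage_viswanathan_base_def fps_divide_unit)

(* The value at x, y in a field of characteristic 0, x \<noteq> 1; at the indeterminates of
   Q(x,y) it is the polynomial itself, as an element of Q(x,y). *)
definition savage_viswanathan :: "'a::field_char_0 \<Rightarrow> 'a \<Rightarrow> nat \<Rightarrow> 'a" where
  "savage_viswanathan x y n =
     fact n * fps_nth (fps_pow_exp_ln (savage_viswanathan_base x) y) n"

(* L is uniquely determined by linearity and its moments, since the monomials form a basis. *)
definition orthogonal_with_moments ::
    "(nat \<Rightarrow> 'a::field poly) \<Rightarrow> (nat \<Rightarrow> 'a) \<Rightarrow> bool" where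
  "orthogonal_with_moments p \<mu> \<longleftrightarrow>
     (\<forall>n. degree (p n) = n \<and> lead_coeff (p n) = 1) \<and>
     (\<exists>L. Vector_Spaces.linear smult (*) L \<and>
          (\<forall>n. L (monom 1 n) = \<mu> n) \<and>
          (\<forall>m n. m \<noteq> n \<longrightarrow> L (p m * p n) = 0) \<and>
          (\<forall>n. L ((p n)^2) \<noteq> 0))"

fun Q_poly :: "'a::field_char_0 \<Rightarrow> 'a \<Rightarrow> nat \<Rightarrow> 'a poly" where
  "Q_poly x y 0 = 1"
| "Q_poly x y (Suc 0) = [:- y, 1:]"
| "Q_poly x y (Suc (Suc m)) =
     [:- (y + of_nat (m + 1) * (1 + x)), 1:] * Q_poly x y (Suc m)
     - smult (of_nat (m + 1) * (x * y + of_nat m * x)) (Q_poly x y m)"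

end

(* Let u be the base series, f = u^y its power and w = u - 1. Then
   w' = (1 + w)(1 + x w) and f' = y f (1 + x w). Let Phi send a polynomial p to the exponential
   generating function of L(z^n p), so that Phi 1 = f and Phi (z p) = (Phi p)'. By these
   differential equations the recurrence gives Phi (Q_n) = x^n y (y+1) ... (y+n-1) w^n f. As w
   has order 1, L(z^m Q_n) vanishes for m < n and is the product of n! and x^n y ... (y+n-1)
   for m = n. *)
theory Submission
  imports Defs
begin

section \<open>Differential equations for the base series and its powers\<close>

lemma savage_viswanathan_base_deriv:
  fixes x :: "'a::field_char_0"
  assumes "x \<noteq> 1"
  defines "u \<equiv> savage_viswanathan_base x"
  shows "fps_deriv u = u * (fps_const (1 - x) + fps_const x * u)"
proof -
  let ?E = "fps_exp (x - 1)"
  have uE: "u * (?E - fps_const x) = fps_const (1 - x)"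
    unfolding u_def savage_viswanathan_base_def using assms(1)
    by (simp add: fps_divide_unit mult.assoc inverse_mult_eq_1)
  then have E: "u * ?E = fps_const (1 - x) + fps_const x * u"
    by (simp add: algebra_simps)
  have "fps_deriv (u * (?E - fps_const x)) = 0"
    by (simp only: uE fps_deriv_const)
  then have "fps_deriv u * (?E - fps_const x) = fps_const (1 - x) * (u * ?E)"
    by (simp add: algebra_simps flip: fps_const_sub)
  \<comment> \<open>Multiplying by u turns the factor \<open>?E - fps_const x\<close> into the
    constant 1 - x, which cancels as x \<noteq> 1. The exponential then survives only in
    \<open>u * ?E\<close>, which is affine in u.\<close>
  then have "u * (fps_deriv u * (?E - fps_const x)) = u * (fps_const (1 - x) * (u * ?E))"
    by simp
  then have "fps_const (1 - x) * fps_deriv u = fps_const (1 - x) * (u * (u * ?E))"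
    by (simp only: flip: uE) (simp only: ac_simps)
  then show ?thesis
    unfolding E using assms(1) by simp
qed

lemma fps_pow_exp_ln_nth_0 [simp]: "fps_nth (fps_pow_exp_ln u a) 0 = 1"
  by (simp add: fps_pow_exp_ln_def fps_compose_nth)

text \<open>The chain rule for exp and ln: the logarithmic derivative of u^a is a times that of u.
  Constant term 1 makes u - 1 admissible as inner series.\<close>

lemma fps_pow_exp_ln_deriv:
  fixes u :: "'a::field_char_0 fps"
  assumes "fps_nth u 0 = 1"
  shows "fps_deriv (fps_pow_exp_ln u a)
    = fps_const a * fps_pow_exp_ln u a * (fps_deriv u * inverse u)"
proof -
  let ?l = "fps_ln 1 oo (u - 1)"
  have "fps_deriv ?l = (inverse (1 + fps_X) oo (u - 1)) * fps_deriv u"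
    using assms by (simp add: fps_compose_deriv fps_ln_deriv)
  also have "inverse (1 + fps_X) oo (u - 1) = inverse u"
    using assms by (simp add: fps_inverse_compose fps_compose_add_distrib)
  finally have "fps_deriv ?l = inverse u * fps_deriv u" .
  moreover have "fps_nth (fps_const a * ?l) 0 = 0"
    by simp
  ultimately show ?thesis
    unfolding fps_pow_exp_ln_def by (simp add: fps_compose_deriv ac_simps)
qed

section \<open>The moment functional and a criterion for orthogonality\<close>

definition moment_functional :: "(nat \<Rightarrow> 'a::field) \<Rightarrow> 'a poly \<Rightarrow> 'a" where
  "moment_functional \<mu> p = (\<Sum>i\<le>degree p. coeff p i * \<mu> i)"

text \<open>Coefficients beyond the degree vanish; this gives polynomials of different degrees a
  common summation range, as additivity needs.\<close>

lemma moment_functional_eq_sum: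
  assumes "degree p \<le> N"
  shows "moment_functional \<mu> p = (\<Sum>i\<le>N. coeff p i * \<mu> i)"
  unfolding moment_functional_def
  using assms by (intro sum.mono_neutral_left) (auto simp: coeff_eq_0)

lemma moment_functional_add:
  "moment_functional \<mu> (p + q) = moment_functional \<mu> p + moment_functional \<mu> q"
proof -
  define N where "N = max (degree p) (degree q)"
  have "degree (p + q) \<le> N" "degree p \<le> N" "degree q \<le> N"
    by (auto simp: N_def degree_add_le_max)
  then show ?thesis
    by (simp add: moment_functional_eq_sum[where N = N] algebra_simps sum.distrib)
qed

lemma moment_functional_smult:
  "moment_functional \<mu> (smult c p) = c * moment_functional \<mu> p"
  by (simp add: moment_functional_eq_sum[OF degree_smult_le] moment_functional_def
      sum_distrib_left mult.assoc)

lemma moment_functional_monom [simp]: "moment_functional \<mu> (monom 1 n) = \<mu> n"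
  by (simp add: moment_functional_def degree_monom_eq if_distrib[of "\<lambda>c. c * _"] cong: if_cong)

lemma moment_functional_sum:
  "moment_functional \<mu> (\<Sum>i\<in>A. p i) = (\<Sum>i\<in>A. moment_functional \<mu> (p i))"
  by (induction A rule: infinite_finite_induct)
    (simp_all add: moment_functional_add moment_functional_def[of _ 0])

lemma linear_moment_functional: "Vector_Spaces.linear smult (*) (moment_functional \<mu>)"
  unfolding Vector_Spaces.linear_iff
  by (auto simp: moment_functional_add moment_functional_smult vector_space_def algebra_simps
      smult_add_left smult_add_right)

lemma moment_functional_mult:
  "moment_functional \<mu> (p * q)
    = (\<Sum>i\<le>degree p. coeff p i * moment_functional \<mu> (monom 1 i * q))"
proof -
  have "p * q = (\<Sum>i\<le>degree p. monom (coeff p i) i) * q"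
    by (simp add: poly_as_sum_of_monoms)
  also have "\<dots> = (\<Sum>i\<le>degree p. smult (coeff p i) (monom 1 i * q))"
    by (simp add: sum_distrib_right smult_monom flip: mult_smult_left)
  finally show ?thesis
    by (simp add: moment_functional_sum moment_functional_smult)
qed

text \<open>Testing against monomials suffices: for m < n, expand \<open>p m\<close> into monomials
  of degree below n. In the square of \<open>p n\<close> only the leading monomial of one factor
  contributes, with coefficient 1.\<close>

lemma orthogonal_with_momentsI:
  assumes "\<And>n. degree (p n) = n" and "\<And>n. lead_coeff (p n) = 1"
    and lower: "\<And>m n. m < n \<Longrightarrow> moment_functional \<mu> (monom 1 m * p n) = 0"
    and diag: "\<And>n. moment_functional \<mu> (monom 1 n * p n) \<noteq> 0"
  shows "orthogonal_with_moments p \<mu>"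
proof -
  let ?L = "moment_functional \<mu>"
  have less: "?L (p m * p n) = 0" if "m < n" for m n
    using that by (simp add: moment_functional_mult[of \<mu> "p m"] assms(1) lower)
  then have "?L (p m * p n) = 0" if "m \<noteq> n" for m n
    using that by (metis mult.commute nat_neq_iff)
  moreover have "?L ((p n)\<^sup>2) = ?L (monom 1 n * p n)" for n
  proof -
    have "?L ((p n)\<^sup>2) = (\<Sum>i\<le>n. coeff (p n) i * ?L (monom 1 i * p n))"
      by (simp add: power2_eq_square moment_functional_mult[of \<mu> "p n" "p n"] assms(1))
    also have "\<dots> = (\<Sum>i\<in>{n}. coeff (p n) i * ?L (monom 1 i * p n))"
      by (rule sum.mono_neutral_right) (auto simp: lower)
    finally show ?thesis
      using assms(2)[of n] by (simp add: assms(1))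
  qed
  ultimately show ?thesis
    unfolding orthogonal_with_moments_def
    using assms(1,2) diag linear_moment_functional[of \<mu>] by auto
qed

section \<open>The map Phi, here \<open>moment_egf\<close>, and its values on the polynomials
  Q_n\<close>

definition moment_egf :: "(nat \<Rightarrow> 'a::field_char_0) \<Rightarrow> 'a poly \<Rightarrow> 'a fps" where
  "moment_egf \<mu> p = Abs_fps (\<lambda>n. moment_functional \<mu> (monom 1 n * p) / fact n)"

lemma moment_egf_add: "moment_egf \<mu> (p + q) = moment_egf \<mu> p + moment_egf \<mu> q"
  by (simp add: moment_egf_def fps_eq_iff distrib_left moment_functional_add add_divide_distrib)

lemma moment_egf_smult: "moment_egf \<mu> (smult c p) = fps_const c * moment_egf \<mu> p"
  by (simp add: moment_egf_def fps_eq_iff moment_functional_smult)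

lemma moment_egf_diff: "moment_egf \<mu> (p - q) = moment_egf \<mu> p - moment_egf \<mu> q"
  using moment_egf_add[of \<mu> "p - q" q] by simp

text \<open>A factor z shifts the sequence of moments by one place, and the division by n! makes
  this shift a derivative.\<close>

lemma moment_egf_linear_factor:
  "moment_egf \<mu> ([:- b, 1:] * p) = fps_deriv (moment_egf \<mu> p) - fps_const b * moment_egf \<mu> p"
proof -
  have "monom 1 n * pCons 0 p = monom 1 (Suc n) * p" for n
    by (simp add: monom_Suc)
  then have "moment_egf \<mu> (pCons 0 p) = fps_deriv (moment_egf \<mu> p)"
    by (simp add: moment_egf_def fps_eq_iff field_simps del: of_nat_Suc)
  moreover have "[:- b, 1:] * p = pCons 0 p - smult b p"
    by (simp add: algebra_simps)
  ultimately show ?thesis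
    by (simp only: moment_egf_diff moment_egf_smult)
qed

lemma Q_poly_monic: "degree (Q_poly x y n) = n \<and> lead_coeff (Q_poly x y n) = 1"
proof (induction x y n rule: Q_poly.induct)
  case (3 x y m)
  let ?b = "y + of_nat (m + 1) * (1 + x)"
  let ?p = "[:- ?b, 1:] * Q_poly x y (Suc m)"
  let ?q = "smult (of_nat (m + 1) * (x * y + of_nat m * x)) (Q_poly x y m)"
  have "Q_poly x y (Suc m) \<noteq> 0"
    using "3.IH"(1) by auto
  then have p: "degree ?p = Suc (Suc m)"
    using "3.IH"(1) by (subst degree_mult_eq) auto
  \<comment> \<open>Only a bound, since the scalar in \<open>?q\<close> may vanish for special x and
    y.\<close>
  have "degree ?q \<le> m"
    using "3.IH"(2) degree_smult_le by metis
  then have q: "degree ?q < Suc (Suc m)"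
    by simp
  have "lead_coeff ?p = 1"
    using "3.IH"(1) by (subst lead_coeff_mult) auto
  moreover have "degree (?p - ?q) = Suc (Suc m)"
    using degree_add_eq_left[of "- ?q" ?p] p q by simp
  ultimately show ?case
    using p q coeff_eq_0[OF q] by (simp del: mult_pCons_left)
qed auto

lemma moment_egf_Q_poly:
  fixes x y :: "'a::field_char_0"
  assumes "x \<noteq> 1"
  defines "u \<equiv> savage_viswanathan_base x"
  shows "moment_egf (savage_viswanathan x y) (Q_poly x y n)
    = fps_const (x ^ n * pochhammer y n) * (u - 1) ^ n * fps_pow_exp_ln u y"
proof -
  define f w X Y where "f = fps_pow_exp_ln u y" and "w = u - 1"
    and "X = fps_const x" and "Y = fps_const y"
  let ?\<Phi> = "moment_egf (savage_viswanathan x y)"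
  have u0: "fps_nth u 0 = 1"
    unfolding u_def by (rule savage_viswanathan_base_nth_0[OF assms(1)])
  have u: "u = 1 + w"
    by (simp add: w_def)
  have u': "fps_deriv u = u * (1 + X * w)"
    using savage_viswanathan_base_deriv[OF assms(1)]
    by (simp add: w_def X_def flip: u_def fps_const_sub) (simp add: algebra_simps)
  then have w': "fps_deriv w = (1 + w) * (1 + X * w)"
    by (simp add: w_def)
  have "inverse u * u = 1"
    using u0 by (simp add: inverse_mult_eq_1)
  then have "fps_deriv u * inverse u = 1 + X * w"
    by (simp add: u' mult.commute mult.left_commute)
  then have f': "fps_deriv f = Y * f * (1 + X * w)"
    by (simp add: f_def Y_def fps_pow_exp_ln_deriv[OF u0])
  \<comment> \<open>Sorted by powers of w, using (1 + w)(1 + x w) = 1 + (1 + x) w + x w^2. For n = 0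
    the truncated exponent n - 1 is harmless, as its factor n is 0.\<close>
  have deriv: "fps_deriv (w ^ n * f) = of_nat n * w ^ (n - 1) * f
      + (Y + of_nat n * (1 + X)) * (w ^ n * f) + X * (Y + of_nat n) * (w ^ Suc n * f)" for n
  proof (cases n)
    case (Suc m)
    have "fps_deriv (w ^ n) = of_nat n * (1 + w) * (1 + X * w) * w ^ m"
      by (simp only: fps_deriv_power' w' Suc diff_Suc_1 mult.assoc)
    then show ?thesis
      by (simp add: Suc f' algebra_simps)
  qed (simp add: f' algebra_simps)
  have zero: "?\<Phi> 1 = f"
    by (simp add: moment_egf_def savage_viswanathan_def f_def u_def fps_eq_iff)
  define c where "c n = fps_const (x ^ n * pochhammer y n)" for n
  have c_Suc: "c (Suc n) = X * (Y + of_nat n) * c n" for n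
    by (simp add: c_def X_def Y_def pochhammer_Suc fps_of_nat[symmetric] algebra_simps)
  have "?\<Phi> (Q_poly x y n) = c n * (w ^ n * f)"
  proof (induction n rule: induct_nat_012)
    case 0
    then show ?case
      by (simp add: zero c_def)
  next
    case 1
    \<comment> \<open>The product form makes the rule for a linear factor applicable.\<close>
    have "Q_poly x y (Suc 0) = [:- y, 1:] * 1"
      by simp
    then have "?\<Phi> (Q_poly x y (Suc 0)) = fps_deriv f - Y * f"
      by (simp only: moment_egf_linear_factor zero Y_def)
    then show ?case
      by (simp add: f' c_Suc c_def[of 0] algebra_simps)
  next
    case (ge2 n)
    let ?b = "Y + of_nat (Suc n) * (1 + X)"
    have b: "fps_const (y + of_nat (n + 1) * (1 + x)) = ?b"
      by (simp add: X_def Y_def fps_of_nat[symmetric] algebra_simps)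
    have l: "fps_const (of_nat (n + 1) * (x * y + of_nat n * x)) = of_nat (Suc n) * X * (Y + of_nat n)"
      by (simp add: X_def Y_def fps_of_nat[symmetric] algebra_simps)
    have "fps_deriv (c (Suc n) * (w ^ Suc n * f)) = c (Suc n) * fps_deriv (w ^ Suc n * f)"
      by (simp add: c_def)
    then have "?\<Phi> (Q_poly x y (Suc (Suc n))) = c (Suc n) * fps_deriv (w ^ Suc n * f)
        - ?b * (c (Suc n) * (w ^ Suc n * f))
        - of_nat (Suc n) * X * (Y + of_nat n) * (c n * (w ^ n * f))"
      by (simp only: Q_poly.simps moment_egf_diff moment_egf_smult moment_egf_linear_factor
          ge2 b l)
    \<comment> \<open>The recurrence coefficients cancel exactly the terms of the derivative in
      w^(n+1) f and, by \<open>c_Suc\<close>, in w^n f. The remaining factor x (y + n + 1) raises c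
      to its next value.\<close>
    also have "\<dots> = c (Suc (Suc n)) * (w ^ Suc (Suc n) * f)"
      unfolding deriv by (simp add: c_Suc algebra_simps)
    finally show ?case .
  qed
  then show ?thesis
    by (simp add: c_def w_def f_def mult.assoc)
qed

section \<open>Orthogonality from the order of w^n f\<close>

lemma fps_power_mult_nth_eq_0:
  fixes w :: "'a::idom fps"
  assumes "fps_nth w 0 = 0" and "m < n"
  shows "fps_nth (w ^ n * g) m = 0"
  using assms by (simp add: fps_mult_nth startsby_zero_power_prefix)

lemma fps_power_mult_nth_same:
  fixes w :: "'a::idom fps"
  assumes "fps_nth w 0 = 0"
  shows "fps_nth (w ^ n * g) n = fps_nth w 1 ^ n * fps_nth g 0"
proof -
  have "fps_nth (w ^ n * g) n = (\<Sum>i\<in>{n}. fps_nth (w ^ n) i * fps_nth g (n - i))"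
    unfolding fps_mult_nth
    using assms by (intro sum.mono_neutral_right) (auto simp: startsby_zero_power_prefix)
  then show ?thesis
    using assms by (simp add: startsby_zero_power_nth_same)
qed

text \<open>L(Q_n^2) is n! x^n y (y+1) ... (y+n-1), which the conditions on x = 0 and on
  \<open>pochhammer\<close> keep nonzero; x \<noteq> 1 makes the denominator of the base series
  invertible.\<close>

lemma orthogonal_Q_poly:
  fixes x y :: "'a::field_char_0"
  assumes "x \<noteq> 0" "x \<noteq> 1" and y: "\<And>n. pochhammer y n \<noteq> 0"
  shows "orthogonal_with_moments (Q_poly x y) (savage_viswanathan x y)"
proof (rule orthogonal_with_momentsI)
  define u where "u = savage_viswanathan_base x"
  let ?L = "moment_functional (savage_viswanathan x y)"
  have u0: "fps_nth u 0 = 1"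
    unfolding u_def by (rule savage_viswanathan_base_nth_0[OF assms(2)])
  then have w0: "fps_nth (u - 1) 0 = 0"
    by simp
  \<comment> \<open>The differential equation at z = 0 shows that w = u - 1 starts with z, so w^n f
    has coefficient 1 at z^n.\<close>
  have "fps_nth (fps_deriv u) 0 = 1"
    unfolding u_def savage_viswanathan_base_deriv[OF assms(2)] by (simp add: u0[unfolded u_def])
  then have w1: "fps_nth (u - 1) 1 = 1"
    by simp
  have L: "?L (monom 1 m * Q_poly x y n)
    = fact m * (x ^ n * pochhammer y n * fps_nth ((u - 1) ^ n * fps_pow_exp_ln u y) m)" for m n
  proof -
    have "?L (monom 1 m * Q_poly x y n) =
        fact m * fps_nth (moment_egf (savage_viswanathan x y) (Q_poly x y n)) m"
      by (simp add: moment_egf_def)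
    then show ?thesis
      by (simp add: moment_egf_Q_poly[OF assms(2)] mult.assoc flip: u_def)
  qed
  show "?L (monom 1 m * Q_poly x y n) = 0" if "m < n" for m n
    using that by (simp add: L fps_power_mult_nth_eq_0[OF w0])
  show "?L (monom 1 n * Q_poly x y n) \<noteq> 0" for n
    using assms(1) y[of n] w1 by (simp add: L fps_power_mult_nth_same[OF w0])
qed (use Q_poly_monic in auto)

lemma of_nat_ratfun2: "(of_nat n :: ratfun2) = to_fract (of_nat n)"
  by (induction n) auto

theorem corollary6:
  shows "orthogonal_with_moments (Q_poly indet_x indet_y) (savage_viswanathan indet_x indet_y)"
proof (rule orthogonal_Q_poly)
  show "indet_x \<noteq> 0"
    by (simp add: indet_x_def)
  \<comment> \<open>With 1 written as a fraction too, injectivity of \<open>to_fract\<close> reduces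
    the claim to polynomials.\<close>
  have "to_fract [:[:0, 1:]:] \<noteq> (to_fract 1 :: ratfun2)"
    by (simp only: to_fract_eq_iff) (simp add: one_pCons)
  then show "indet_x \<noteq> 1"
    by (simp add: indet_x_def)
  \<comment> \<open>These are the factors of \<open>pochhammer\<close>; each comes from a polynomial
    of degree 1 in the outer variable.\<close>
  have "indet_y + of_nat k \<noteq> 0" for k
  proof -
    have "[:0, 1:] + of_nat k \<noteq> (0 :: rat poly poly)"
      by (simp add: of_nat_poly)
    then show ?thesis
      by (simp add: indet_y_def of_nat_ratfun2 flip: to_fract_add)
  qed
  then show "pochhammer indet_y n \<noteq> 0" for n
    by (simp add: pochhammer_prod)
qed

end
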